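(* Let $b\in\mathbb{Z}$. (1) Let $x_1,x_2,x_3$ be the three (distinct, real, irrational) roots of the equation $x^3-bx^2+(b-3)x+1=0$, and let $X_i(q)=[x_i]_q\in\mathbb{Z}((q))$, $i=1,2,3$, be their $q$-deformations. Then there exists a Laurent series $B_-(q)\in\mathbb{Z}((q))$ (depending on $b$) such that $X=X_1(q)$, $X=X_2(q)$ and $X=X_3(q)$ all satisfy the equation $$X^3-B_-(q)X^2+\left(B_-(q)-3\right)X+1=0.$$ (2) Let $x_1,x_2,x_3$ be the three (distinct, real, irrational) roots of the equation $x^3-bx^2-(b+3)x-1=0$, and let $X_i(q)=[x_i]_q\in\mathbb{Z}((q))$, $i=1,2,3$, be their $q$-deformations. Then there exists a Laurent series $B_+(q)\in\mathbb{Z}((q))$ (depending on $b$) such that $X=X_1(q)$, $X=X_2(q)$ and $X=X_3(q)$ all satisfy the equation $$X^3-B_+(q)X^2-\left(q^{-1}B_+(q)+3q^{-2}\right)X-q^{-3}=0.$$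
   Context: $\mathbb{Z}((q))$ denotes the ring of formal Laurent series in $q$ with integer coefficients (finitely many negative powers of $q$). $q$-deformed rationals: the map $[\,\cdot\,]_q:\mathbb{Q}\cup\{\infty\}\to\mathbb{Z}(q)\cup\{\infty\}$, where $\mathbb{Z}(q)$ is the set of rational functions in $q$ with integer coefficients, is the unique map with $[0]_q=0$ and, for all $x$, $$[x+1]_q=q[x]_q+1,\qquad \left[-\tfrac1x\right]_q=-\frac{1}{q[x]_q}$$ (with the usual conventions for $0$ and $\infty$). Equivalently, it commutes with the action of $\mathrm{PSL}(2,\mathbb{Z})$, generated by $T(x)=x+1$, $S(x)=-1/x$ on $\mathbb{Q}\cup\{\infty\}$ and by $T_q(F)=qF+1$, $S_q(F)=-1/(qF)$ on rational functions. $q$-deformed irrationals: for $x\in\mathbb{R}\setminus\mathbb{Q}$ and any sequence of rationals $(x_n)$ converging to $x$, the Laurent expansions at $q=0$ of the rational functions $[x_n]_q$ converge coefficientwise (in the topology of formal series) to a Laurent series in $\mathbb{Z}((q))$ that does not depend on the sequence; this limit is by definition $[x]_q$. (For $x>0$ it is a power series; for negative $x$ it can equivalently be obtained from $[x-1]_q=([x]_q-1)/q$.) It is known that this is well defined and that the two displayed rules remain valid for irrational $x$. *)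

theory Defs
  imports
    Complex_Main
    "HOL-Computational_Algebra.Computational_Algebra"
begin

text \<open>The set \<open>K \<union> {\<infinity>}\<close> for a field \<open>K\<close>.\<close>

datatype 'a with_infinity = Finite (finite_part: 'a) | Infinity

text \<open>
  \<open>shift_map a x = a x + 1\<close> and \<open>neg_recip_map a x = - 1 / (a x)\<close> for \<open>a \<noteq> 0\<close>, with the usual
  conventions for \<open>0\<close> and \<open>\<infinity>\<close>. The value \<open>a = 1\<close> gives \<open>T\<close> and \<open>S\<close>; the value \<open>a = q\<close> gives
  \<open>T\<^sub>q\<close> and \<open>S\<^sub>q\<close>.
\<close>

fun shift_map :: "'a::field \<Rightarrow> 'a with_infinity \<Rightarrow> 'a with_infinity" where
  "shift_map a (Finite x) = Finite (a * x + 1)"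
| "shift_map a Infinity = Infinity"

fun neg_recip_map :: "'a::field \<Rightarrow> 'a with_infinity \<Rightarrow> 'a with_infinity" where
  "neg_recip_map a (Finite x) = (if x = 0 then Infinity else Finite (- 1 / (a * x)))"
| "neg_recip_map a Infinity = Finite 0"

text \<open>\<open>\<int>(q)\<close> is the fraction field of \<open>\<int>[q]\<close>.\<close>

definition q_var :: "int poly fract" where
  "q_var = Fract [:0, 1:] 1"

definition is_q_deformation :: "(rat with_infinity \<Rightarrow> int poly fract with_infinity) \<Rightarrow> bool" where
  "is_q_deformation f \<longleftrightarrow>
     f (Finite 0) = Finite 0 \<and>
     (\<forall>x. f (shift_map 1 x) = shift_map q_var (f x)) \<and>
     (\<forall>x. f (neg_recip_map 1 x) = neg_recip_map q_var (f x))"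

definition q_rational :: "rat with_infinity \<Rightarrow> int poly fract with_infinity" where
  "q_rational = (THE f. is_q_deformation f)"

text \<open>
  Laurent expansion at \<open>q = 0\<close>. It is taken in \<open>\<rat>((q))\<close>, where every element of \<open>\<int>(q)\<close> has an
  expansion; an expansion with integer coefficients exists only for some of them.
\<close>

definition fls_of_int_poly :: "int poly \<Rightarrow> rat fls" where
  "fls_of_int_poly p = fps_to_fls (fps_of_poly (map_poly of_int p))"

definition laurent_expansion :: "int poly fract \<Rightarrow> rat fls" where
  "laurent_expansion F =
     fls_of_int_poly (fst (quot_of_fract F)) / fls_of_int_poly (snd (quot_of_fract F))"

lemma fls_of_int_poly_mult: "fls_of_int_poly (p * r) = fls_of_int_poly p * fls_of_int_poly r"
proof -
  have "map_poly of_int (p * r) = map_poly of_int p * (map_poly of_int r :: rat poly)"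
    by (rule poly_eqI) (simp add: coeff_map_poly coeff_mult)
  then show ?thesis
    by (simp add: fls_of_int_poly_def fps_of_poly_mult fls_times_fps_to_fls)
qed

lemma fls_of_int_poly_eq_0_iff: "fls_of_int_poly p = 0 \<longleftrightarrow> p = 0"
  by (auto simp: fls_of_int_poly_def map_poly_eq_0_iff)

lemma laurent_expansion_Fract:
  assumes "d \<noteq> 0"
  shows "laurent_expansion (Fract p d) = fls_of_int_poly p / fls_of_int_poly d"
proof -
  obtain p' d' where pd: "quot_of_fract (Fract p d) = (p', d')"
    by (cases "quot_of_fract (Fract p d)")
  have d': "d' \<noteq> 0"
    using snd_quot_of_fract_nonzero[of "Fract p d"] pd by simp
  have "Fract p' d' = Fract p d"
    using Fract_quot_of_fract[of "Fract p d"] pd by simp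
  then have "p' * d = p * d'"
    using d' assms by (simp add: eq_fract)
  then have "fls_of_int_poly p' * fls_of_int_poly d = fls_of_int_poly p * fls_of_int_poly d'"
    by (metis fls_of_int_poly_mult)
  then show ?thesis
    using d' assms
    by (simp add: laurent_expansion_def pd frac_eq_eq fls_of_int_poly_eq_0_iff)
qed

text \<open>
  Coefficientwise convergence of the Laurent expansions of \<open>[x\<^sub>n]\<^sub>q\<close> to a series in \<open>\<int>((q))\<close>;
  the coefficients carry the discrete topology. The value \<open>[x\<^sub>n]\<^sub>q\<close> is never \<open>\<infinity>\<close>, since \<open>x\<^sub>n\<close> is
  a rational number.
\<close>

definition q_tendsto :: "(nat \<Rightarrow> rat) \<Rightarrow> int fls \<Rightarrow> bool" where
  "q_tendsto xs L \<longleftrightarrow>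
     (\<forall>k. \<forall>\<^sub>F n in sequentially.
        fls_nth (laurent_expansion (finite_part (q_rational (Finite (xs n))))) k = of_int (fls_nth L k))"

text \<open>Meant for irrational \<open>x\<close> only.\<close>

definition q_irrational :: "real \<Rightarrow> int fls" where
  "q_irrational x =
     (THE L. \<forall>xs. (\<lambda>n. of_rat (xs n)) \<longlonglongrightarrow> x \<longrightarrow> q_tendsto xs L)"

end

theory Submission
  imports Defs
begin

text \<open>
  The roots of each cubic are permuted cyclically by an element of order three of \<open>PSL(2,\<int>)\<close>,
  \<open>x \<mapsto> 1 - 1/x\<close> for the first and \<open>x \<mapsto> - 1 - 1/x\<close> for the second. Deformation commutes with the
  modular group, so the deformed roots satisfy \<open>X Y = - u X - u\<^sup>2\<close> and its two cyclic shifts, with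
  \<open>u = - 1\<close> and \<open>u = q\<^sup>-\<^sup>1\<close> respectively. These relations express the second and third elementary
  symmetric functions of \<open>X, Y, Z\<close> through the first, which is the required \<open>B\<close>.
\<close>

subsection \<open>Deformed rationals\<close>

text \<open>Both \<open>q_rational\<close> and \<open>q_irrational\<close> are definite
  descriptions, so existence and uniqueness have to be established before any deformation rule can
  be used. Since \<open>int fls\<close> is not a field, the rule for \<open>- 1 / x\<close> is
  carried through as the product identity \<open>q [x] [- 1 / x] = - 1\<close>.

  The constant \<open>u\<close> records how many powers of \<open>q\<close> survive. The map
  \<open>x \<mapsto> 1 - 1/x\<close> is \<open>T S\<close>, and its deformation is
  \<open>q * (- 1 / (q X)) + 1 = 1 - 1 / X\<close>: the powers of \<open>q\<close> cancel, so
  \<open>u = - 1\<close>. The map \<open>x \<mapsto> - 1 - 1/x\<close> is \<open>T\<close> inverse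
  after \<open>S\<close>, and its deformation is \<open>(- 1 / (q X) - 1) / q\<close>. Multiplying
  by \<open>X\<close> gives \<open>- u X - u^2\<close> with \<open>u\<close> the inverse of
  \<open>q\<close>. At \<open>q = 1\<close> these are the relations between the real roots, so one
  algebraic lemma serves both the classical and the deformed cubics.\<close>

lemma rat_size_decreasing:
  fixes r :: rat
  assumes "0 < r"
  shows rat_size_diff_one:
      "1 \<le> r \<Longrightarrow> fst (quotient_of (r - 1)) + snd (quotient_of (r - 1))
         < fst (quotient_of r) + snd (quotient_of r)"
    and rat_size_slope:
      "r < 1 \<Longrightarrow> fst (quotient_of (r / (1 - r))) + snd (quotient_of (r / (1 - r)))
         < fst (quotient_of r) + snd (quotient_of r)"
    and rat_size_pos: "0 < fst (quotient_of r) + snd (quotient_of r)"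
proof -
  \<comment> \<open>Both moves keep the fraction reduced: \<open>a/b\<close> becomes
    \<open>(a - b)/b\<close> or \<open>a/(b - a)\<close>, so the size can be read off
    directly.\<close>
  obtain a b where r: "r = Rat.Fract a b" and b: "b > 0" and ab: "coprime a b"
    by (cases r)
  have a: "a > 0"
    using assms b by (simp add: r Rat.zero_less_Fract_iff)
  have q: "quotient_of r = (a, b)"
    using b ab by (simp add: r quotient_of_Fract)
  show "0 < fst (quotient_of r) + snd (quotient_of r)"
    using a b by (simp add: q)
  {
    assume "1 \<le> r"
    have "r - 1 = Rat.Fract (a - b) b"
      using b by (simp add: r One_rat_def)
    moreover have "coprime (a - b) b"
      using ab by (metis coprime_iff_gcd_eq_1 gcd_diff1)
    ultimately have "quotient_of (r - 1) = (a - b, b)"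
      using b by (simp add: quotient_of_Fract)
    then show "fst (quotient_of (r - 1)) + snd (quotient_of (r - 1))
         < fst (quotient_of r) + snd (quotient_of r)"
      using b by (simp add: q)
  }
  {
    assume "r < 1"
    then have "a < b"
      using b by (simp add: r Rat.Fract_less_one_iff)
    have "r / (1 - r) = Rat.Fract a (b - a)"
      using b \<open>a < b\<close> by (simp add: r Fract_of_int_quotient field_simps)
    moreover have "coprime a (b - a)"
      using ab by (metis coprime_iff_gcd_eq_1 gcd.commute gcd_diff1)
    ultimately have "quotient_of (r / (1 - r)) = (a, b - a)"
      using \<open>a < b\<close> by (simp add: quotient_of_Fract)
    then show "fst (quotient_of (r / (1 - r))) + snd (quotient_of (r / (1 - r)))
         < fst (quotient_of r) + snd (quotient_of r)"
      using a by (simp add: q)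
  }
qed

text \<open>
  The rules of the deformation give \<open>[r / (1 + r)]\<^sub>q = 1 - 1 / (1 + q [r]\<^sub>q)\<close>, so it is computed on
  the positive rationals by descending the Stern--Brocot tree.
\<close>

function q_pos :: "rat \<Rightarrow> int poly fract" where
  "q_pos r =
     (if r \<le> 0 then 0
      else if r < 1 then 1 - 1 / (1 + q_var * q_pos (r / (1 - r)))
      else q_var * q_pos (r - 1) + 1)"
  by auto
termination
  by (relation "measure (\<lambda>r. nat (fst (quotient_of r) + snd (quotient_of r)))")
    (use rat_size_decreasing in \<open>auto simp: not_le not_less intro!: nat_mono_iff[THEN iffD2]\<close>)

declare q_pos.simps [simp del]

text \<open>The recursion of \<open>q_pos\<close> read upwards: \<open>r - 1\<close> and
  \<open>r / (1 - r)\<close> are undone by \<open>r + 1\<close> and \<open>r / (1 + r)\<close>, and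
  the descent ends at 0.\<close>

lemma rat_stern_brocot_induct [consumes 1, case_names zero shift slope]:
  fixes r :: rat
  assumes "0 \<le> r" and "P 0"
    and shift: "\<And>r. 0 \<le> r \<Longrightarrow> P r \<Longrightarrow> P (r + 1)"
    and slope: "\<And>r. 0 < r \<Longrightarrow> P r \<Longrightarrow> P (r / (1 + r))"
  shows "P r"
  using assms(1)
proof (induction r rule: q_pos.induct)
  case (1 r)
  consider "r = 0" | "0 < r" "r < 1" | "1 \<le> r"
    using "1.prems" by linarith
  then show ?case
  proof cases
    case 2
    define t where "t = r / (1 - r)"
    have "0 < t" "r = t / (1 + t)"
      using 2 by (simp_all add: t_def field_simps)
    moreover have "P t"
      unfolding t_def by (rule "1.IH"(1)) (use 2 in simp_all)
    ultimately show ?thesis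
      using slope by metis
  next
    case 3
    then have "P (r - 1)"
      by (intro "1.IH"(2)) simp_all
    then show ?thesis
      using shift[of "r - 1"] 3 by simp
  qed (simp add: \<open>P 0\<close>)
qed

text \<open>The order on \<open>int poly fract\<close> goes by leading coefficients, so
  \<open>q\<close> is infinitely large. It is unrelated to expansion at \<open>q = 0\<close>; it
  serves to show that denominators do not vanish, by positivity.\<close>

lemma q_var_pos: "0 < q_var"
proof -
  have "0 < [:0, 1 :: int:]"
    by (simp add: less_poly_def pos_poly_pCons)
  then show ?thesis
    by (simp add: q_var_def Fraction_Field.zero_less_Fract_iff)
qed

lemma q_pos_0 [simp]: "q_pos 0 = 0"
  by (simp add: q_pos.simps)

lemma q_pos_add_one: "0 \<le> r \<Longrightarrow> q_pos (r + 1) = q_var * q_pos r + 1"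
  by (subst q_pos.simps) auto

lemma q_pos_slope:
  assumes "0 < r"
  shows "q_pos (r / (1 + r)) = 1 - 1 / (1 + q_var * q_pos r)"
proof -
  have "0 < r / (1 + r)" "r / (1 + r) < 1" "r / (1 + r) / (1 - r / (1 + r)) = r"
    using assms by (simp_all add: field_simps)
  then show ?thesis
    by (subst q_pos.simps) (simp add: not_le)
qed

lemma q_pos_nonneg: "0 \<le> r \<Longrightarrow> 0 \<le> q_pos r"
proof (induction r rule: rat_stern_brocot_induct)
  case (slope r)
  then have "0 \<le> q_var * q_pos r"
    using q_var_pos by simp
  then show ?case
    using slope by (simp add: q_pos_slope)
qed (use q_var_pos in \<open>simp_all add: q_pos_add_one\<close>)

lemma q_pos_pos:
  assumes "0 < r"
  shows "0 < q_pos r"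
proof -
  \<comment> \<open>The condition \<open>r \<noteq> 0\<close> sits inside the induction because a
    shift may start from 0; there \<open>q_pos_nonneg\<close> takes over from the vacuous induction
    hypothesis.\<close>
  have "0 < q_pos r" if "0 \<le> r" "r \<noteq> 0" for r
    using that
  proof (induction r rule: rat_stern_brocot_induct)
    case (shift r)
    then show ?case
      using q_var_pos q_pos_nonneg[of r] by (simp add: q_pos_add_one add_nonneg_pos)
  next
    case (slope r)
    then have "0 < q_var * q_pos r"
      using q_var_pos by simp
    then show ?case
      using slope by (simp add: q_pos_slope)
  qed simp
  with assms show ?thesis
    by simp
qed

text \<open>For negative \<open>r\<close> the value is forced by the rule for \<open>S\<close> at
  the positive number \<open>- 1 / r\<close>.\<close>

definition q_ext :: "rat with_infinity \<Rightarrow> int poly fract with_infinity" where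
  "q_ext x =
     (case x of Infinity \<Rightarrow> Infinity
      | Finite r \<Rightarrow> Finite (if 0 \<le> r then q_pos r else - 1 / (q_var * q_pos (- 1 / r))))"

lemma q_ext_shift: "q_ext (shift_map 1 x) = shift_map q_var (q_ext x)"
proof (cases x)
  case (Finite r)
  have q: "q_var \<noteq> 0"
    using q_var_pos by simp
  consider "0 \<le> r" | "r = -1" | "r < -1" | "-1 < r" "r < 0"
    by linarith
  then show ?thesis
  proof cases
    case 1
    then show ?thesis
      by (simp add: Finite q_ext_def q_pos_add_one)
  next
    case 2
    have "q_pos 1 = 1"
      using q_pos_add_one[of 0] by simp
    then show ?thesis
      using q by (simp add: Finite q_ext_def 2)
  next
    case 3
    \<comment> \<open>Conjugation by \<open>S\<close> turns \<open>r \<mapsto> r + 1\<close> into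
      \<open>t / (1 + t) \<mapsto> t\<close>, so the slope rule applies.\<close>
    define t where "t = - 1 / (r + 1)"
    have t: "0 < t" "- 1 / r = t / (1 + t)"
      using 3 by (simp_all add: t_def field_simps)
    have "0 < q_var * q_pos t"
      using q_var_pos q_pos_pos[OF t(1)] by simp
    then have "0 < q_var * q_pos t" "0 < 1 + q_var * q_pos t"
      by simp_all
    moreover have "q_ext (Finite (r + 1)) = Finite (- 1 / (q_var * q_pos t))"
      using 3 by (simp add: q_ext_def t_def)
    moreover have "q_ext (Finite r) = Finite (- 1 / (q_var * (1 - 1 / (1 + q_var * q_pos t))))"
      using 3 t by (simp add: q_ext_def q_pos_slope)
    ultimately show ?thesis
      using q q_pos_pos[OF t(1)] by (simp add: Finite field_simps)
  next
    case 4
    \<comment> \<open>Here the shift crosses 0: the value at \<open>r\<close> comes from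
      \<open>t + 1\<close>, the value at \<open>r + 1\<close> from \<open>t / (1 + t)\<close>, and
      both are expressed through \<open>q_pos t\<close>.\<close>
    define t where "t = - 1 / r - 1"
    have t: "0 < t" "- 1 / r = t + 1" "r + 1 = t / (1 + t)"
      using 4 by (simp_all add: t_def field_simps)
    have "0 < q_var * q_pos t"
      using q_var_pos q_pos_pos[OF t(1)] by simp
    then have "q_var * q_pos t + 1 \<noteq> 0" "1 + q_var * q_pos t = q_var * q_pos t + 1"
      by simp_all
    moreover have "q_ext (Finite (r + 1)) = Finite (1 - 1 / (1 + q_var * q_pos t))"
      using t 4 by (simp add: q_ext_def q_pos_slope)
    moreover have "q_ext (Finite r) = Finite (- 1 / (q_var * (q_var * q_pos t + 1)))"
      using 4 t by (simp add: q_ext_def q_pos_add_one)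
    ultimately show ?thesis
      using q by (simp add: Finite)
  qed
qed (simp add: q_ext_def)

lemma q_ext_neg_recip: "q_ext (neg_recip_map 1 x) = neg_recip_map q_var (q_ext x)"
proof (cases x)
  case (Finite r)
  have q: "q_var \<noteq> 0"
    using q_var_pos by simp
  consider "r = 0" | "0 < r" | "r < 0"
    by linarith
  then show ?thesis
  proof cases
    case 1
    then show ?thesis
      by (simp add: Finite q_ext_def)
  next
    case 2
    then show ?thesis
      using q_pos_pos[of r] by (simp add: Finite q_ext_def)
  next
    case 3
    then have "0 < q_pos (- 1 / r)"
      by (intro q_pos_pos) (simp add: field_simps)
    then show ?thesis
      using 3 q by (simp add: Finite q_ext_def field_simps)
  qed
qed (simp add: q_ext_def)

lemma is_q_deformation_q_ext: "is_q_deformation q_ext"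
  unfolding is_q_deformation_def
  using q_ext_shift q_ext_neg_recip by (simp add: q_ext_def)

text \<open>Agreement at one point propagates along \<open>T\<close> and \<open>S\<close>. From 0,
  the moves \<open>T\<close> and \<open>T S T\<close>, the latter being
  \<open>r \<mapsto> r / (1 + r)\<close>, reach every nonnegative rational; one more
  \<open>S\<close> reaches the negative ones and \<open>Infinity\<close>.\<close>

lemma is_q_deformation_unique:
  assumes f: "is_q_deformation f" and g: "is_q_deformation g"
  shows "f = g"
proof
  have f_g_shift: "f (shift_map 1 x) = g (shift_map 1 x)" if "f x = g x" for x
    using that f g by (simp add: is_q_deformation_def)
  have neg: "f (neg_recip_map 1 x) = g (neg_recip_map 1 x)" if "f x = g x" for x
    using that f g by (simp add: is_q_deformation_def)
  have nonneg: "f (Finite r) = g (Finite r)" if "0 \<le> r" for r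
    using that
  proof (induction r rule: rat_stern_brocot_induct)
    case zero
    then show ?case
      using f g by (simp add: is_q_deformation_def)
  next
    case (shift r)
    then show ?case
      using f_g_shift[of "Finite r"] by simp
  next
    case (slope r)
    have "shift_map 1 (neg_recip_map 1 (shift_map 1 (Finite r))) = Finite (r / (1 + r))"
      using slope by (simp add: field_simps)
    with f_g_shift[OF neg[OF f_g_shift[OF slope.IH]]] show ?case
      by simp
  qed
  fix x
  show "f x = g x"
  proof (cases x)
    case (Finite r)
    show ?thesis
    proof (cases "0 \<le> r")
      case False
      then have "f (Finite (- 1 / r)) = g (Finite (- 1 / r))"
        by (intro nonneg) (simp add: field_simps)
      from neg[OF this] show ?thesis
        using False by (simp add: Finite)
    qed (simp add: Finite nonneg)
  next
    case Infinity
    then show ?thesis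
      using neg[OF nonneg[of 0]] by simp
  qed
qed

lemma q_rational_eq: "q_rational = q_ext"
  unfolding q_rational_def
  using is_q_deformation_q_ext is_q_deformation_unique by blast

definition q_rat :: "rat \<Rightarrow> int poly fract" where
  "q_rat r = finite_part (q_rational (Finite r))"

lemma q_rational_Finite: "q_rational (Finite r) = Finite (q_rat r)"
  by (simp add: q_rat_def q_rational_eq q_ext_def)

lemma is_q_deformation_q_rational: "is_q_deformation q_rational"
  using is_q_deformation_q_ext by (simp add: q_rational_eq)

lemma q_rat_0 [simp]: "q_rat 0 = 0"
  using is_q_deformation_q_rational by (simp add: is_q_deformation_def q_rational_Finite)

lemma q_rat_add_one: "q_rat (r + 1) = q_var * q_rat r + 1"
proof -
  have "q_rational (shift_map 1 (Finite r)) = shift_map q_var (q_rational (Finite r))"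
    using is_q_deformation_q_rational unfolding is_q_deformation_def by blast
  then show ?thesis
    by (simp add: q_rational_Finite)
qed

lemma q_rat_neg_recip:
  assumes "r \<noteq> 0"
  shows "q_var * q_rat r * q_rat (- 1 / r) = - 1"
proof -
  have "q_rational (neg_recip_map 1 (Finite r)) = neg_recip_map q_var (q_rational (Finite r))"
    using is_q_deformation_q_rational unfolding is_q_deformation_def by blast
  \<comment> \<open>The rule itself yields \<open>q_rat r \<noteq> 0\<close>: otherwise its right
    side would be \<open>Infinity\<close>, while its left side is finite.\<close>
  then show ?thesis
    using assms q_var_pos by (auto simp: q_rational_Finite split: if_splits)
qed

subsection \<open>Integer Laurent series inside rational ones\<close>

unbundle fps_syntax

definition fls_of_int_fls :: "int fls \<Rightarrow> rat fls" where
  "fls_of_int_fls F = Abs_fls (\<lambda>n. of_int (F $$ n))"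

lemma fls_of_int_fls_nth [simp]: "fls_of_int_fls F $$ n = of_int (F $$ n)"
  unfolding fls_of_int_fls_def
  by (rule nth_Abs_fls_lower_bound[of "fls_subdegree F"]) simp

lemma fls_of_int_fls_inject [simp]: "fls_of_int_fls F = fls_of_int_fls G \<longleftrightarrow> F = G"
  by (simp add: fls_eq_iff)

lemma fls_of_int_fls_0 [simp]: "fls_of_int_fls 0 = 0"
  and fls_of_int_fls_1 [simp]: "fls_of_int_fls 1 = 1"
  and fls_of_int_fls_X [simp]: "fls_of_int_fls fls_X = fls_X"
  and fls_of_int_fls_X_inv [simp]: "fls_of_int_fls fls_X_inv = fls_X_inv"
  and fls_of_int_fls_add: "fls_of_int_fls (F + G) = fls_of_int_fls F + fls_of_int_fls G"
  and fls_of_int_fls_diff: "fls_of_int_fls (F - G) = fls_of_int_fls F - fls_of_int_fls G"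
  and fls_of_int_fls_minus: "fls_of_int_fls (- F) = - fls_of_int_fls F"
  by (simp_all add: fls_eq_iff)

lemma fls_subdegree_fls_of_int_fls [simp]: "fls_subdegree (fls_of_int_fls F) = fls_subdegree F"
proof (cases "F = 0")
  case False
  then show ?thesis
    by (intro fls_subdegree_eqI) simp_all
qed simp

text \<open>The convolution sums have ranges given by subdegrees, which the embedding
  preserves.\<close>

lemma fls_of_int_fls_mult: "fls_of_int_fls (F * G) = fls_of_int_fls F * fls_of_int_fls G"
  by (rule fls_eqI) (simp add: fls_times_nth(2))

lemmas fls_of_int_fls_hom =
  fls_of_int_fls_add fls_of_int_fls_diff fls_of_int_fls_minus fls_of_int_fls_mult

lemma fls_of_int_poly_add: "fls_of_int_poly (p + r) = fls_of_int_poly p + fls_of_int_poly r"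
proof -
  have "map_poly of_int (p + r) = map_poly of_int p + (map_poly of_int r :: rat poly)"
    by (rule poly_eqI) (simp add: coeff_map_poly)
  then show ?thesis
    by (simp add: fls_of_int_poly_def fps_of_poly_add)
qed

lemma fls_of_int_poly_1 [simp]: "fls_of_int_poly 1 = 1"
  by (simp add: fls_of_int_poly_def)

lemma laurent_expansion_0 [simp]: "laurent_expansion 0 = 0"
  and laurent_expansion_1 [simp]: "laurent_expansion 1 = 1"
  using laurent_expansion_Fract[of 1 0] laurent_expansion_Fract[of 1 1]
  by (simp_all add: fls_of_int_poly_eq_0_iff flip: Fraction_Field.Zero_fract_def Fraction_Field.One_fract_def)

lemma laurent_expansion_q_var [simp]: "laurent_expansion q_var = fls_X"
  unfolding q_var_def
  by (subst laurent_expansion_Fract) (simp_all add: fls_of_int_poly_def map_poly_pCons fps_of_poly_pCons)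

lemma laurent_expansion_add:
  "laurent_expansion (F + G) = laurent_expansion F + laurent_expansion G"
  by (cases F, cases G)
    (simp add: laurent_expansion_Fract fls_of_int_poly_mult fls_of_int_poly_add
      fls_of_int_poly_eq_0_iff add_frac_eq)

lemma laurent_expansion_mult:
  "laurent_expansion (F * G) = laurent_expansion F * laurent_expansion G"
  by (cases F, cases G) (simp add: laurent_expansion_Fract fls_of_int_poly_mult)

lemma laurent_expansion_minus: "laurent_expansion (- F) = - laurent_expansion F"
  using laurent_expansion_add[of F "- F"] by (simp add: eq_neg_iff_add_eq_0 add.commute)

lemma int_fps_one_plus_X_mult_invertible:
  fixes f :: "int fps"
  obtains g where "g * (1 + fps_X * f) = 1"
  using fps_left_inverse[of 1 "1 + fps_X * f"] by auto

text \<open>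
  On the positive side the slope rule only inverts series with constant term \<open>1\<close>, which keeps the
  coefficients integral.
\<close>

lemma laurent_expansion_q_rat_fps:
  assumes "0 \<le> r"
  shows "\<exists>f. laurent_expansion (q_rat r) = fls_of_int_fls (fps_to_fls f)"
  using assms
proof (induction r rule: rat_stern_brocot_induct)
  case zero
  then show ?case
    by (intro exI[of _ 0]) simp
next
  case (shift r)
  then obtain f where "laurent_expansion (q_rat r) = fls_of_int_fls (fps_to_fls f)"
    by blast
  then have "laurent_expansion (q_rat (r + 1)) = fls_of_int_fls (fps_to_fls (fps_X * f + 1))"
    by (simp add: q_rat_add_one laurent_expansion_add laurent_expansion_mult fls_of_int_fls_hom
        fls_times_fps_to_fls)
  then show ?case
    by blast
next
  case (slope r)
  then obtain f where f: "laurent_expansion (q_rat r) = fls_of_int_fls (fps_to_fls f)"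
    by blast
  obtain g where g: "g * (1 + fps_X * f) = 1"
    by (rule int_fps_one_plus_X_mult_invertible)
  let ?F = "laurent_expansion (q_rat r)" and ?G = "fls_of_int_fls (fps_to_fls g)"
  have "r / (1 + r) = - 1 / (r + 1) + 1"
    using slope by (simp add: field_simps)
  then have eq: "laurent_expansion (q_rat (r / (1 + r))) =
      fls_X * laurent_expansion (q_rat (- 1 / (r + 1))) + 1"
    by (metis q_rat_add_one laurent_expansion_add laurent_expansion_mult laurent_expansion_1
        laurent_expansion_q_var)
  have "laurent_expansion (q_var * q_rat (r + 1) * q_rat (- 1 / (r + 1))) = laurent_expansion (- 1)"
    using slope by (subst q_rat_neg_recip) simp_all
  then have "(fls_X * ?F + 1) * (fls_X * laurent_expansion (q_rat (- 1 / (r + 1)))) = - 1"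
    by (simp add: q_rat_add_one laurent_expansion_mult laurent_expansion_add laurent_expansion_minus
        mult_ac)
  moreover have "?G * (fls_X * ?F + 1) = 1"
    using arg_cong[OF g, of "\<lambda>h. fls_of_int_fls (fps_to_fls h)"]
    by (simp add: f fls_times_fps_to_fls fls_of_int_fls_hom add.commute)
  \<comment> \<open>Up to sign both sides are inverses of \<open>fls_X * ?F + 1\<close>, and
    inverses are unique.\<close>
  ultimately have "fls_X * laurent_expansion (q_rat (- 1 / (r + 1))) = - ?G"
    by algebra
  then have "laurent_expansion (q_rat (r / (1 + r))) = fls_of_int_fls (fps_to_fls (1 - g))"
    by (simp add: eq fls_of_int_fls_hom)
  then show ?case
    by blast
qed

lemma fls_X_inv_mult_X: "fls_X_inv * fls_X = (1 :: 'a :: comm_ring_1 fls)"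
  by (simp add: fls_X_inv_times_conv_shift fls_X_conv_shift_1)

text \<open>Negative rationals are reached by undoing shifts, which only divides by \<open>q\<close>
  and so keeps the coefficients integral.\<close>

lemma laurent_expansion_q_rat_integral:
  "\<exists>F. laurent_expansion (q_rat r) = fls_of_int_fls F"
proof -
  have "\<forall>r. 0 \<le> r + of_nat n \<longrightarrow> (\<exists>F. laurent_expansion (q_rat r) = fls_of_int_fls F)" for n
  proof (induction n)
    case 0
    then show ?case
      using laurent_expansion_q_rat_fps by fastforce
  next
    case (Suc n)
    show ?case
    proof (intro allI impI)
      fix r :: rat
      assume "0 \<le> r + of_nat (Suc n)"
      then have "0 \<le> (r + 1) + of_nat n"
        by (simp add: algebra_simps)
      with Suc obtain F where "laurent_expansion (q_rat (r + 1)) = fls_of_int_fls F"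
        by blast
      then have "fls_X * laurent_expansion (q_rat r) + 1 = fls_of_int_fls F"
        by (simp add: q_rat_add_one laurent_expansion_add laurent_expansion_mult)
      then have "fls_X_inv * (fls_X * laurent_expansion (q_rat r)) = fls_X_inv * (fls_of_int_fls F - 1)"
        by (simp add: eq_diff_eq)
      then have "laurent_expansion (q_rat r) = fls_X_inv * (fls_of_int_fls F - 1)"
        by (simp only: mult.assoc [symmetric] fls_X_inv_mult_X mult_1_left)
      then have "laurent_expansion (q_rat r) = fls_of_int_fls (fls_X_inv * (F - 1))"
        by (simp add: fls_of_int_fls_hom)
      then show "\<exists>F. laurent_expansion (q_rat r) = fls_of_int_fls F"
        by blast
    qed
  qed
  moreover obtain n :: nat where "- r \<le> of_nat n"
    using real_arch_simple by blast
  then have "0 \<le> r + of_nat n"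
    by linarith
  ultimately show ?thesis
    by blast
qed

definition q_series :: "rat \<Rightarrow> int fls" where
  "q_series r = (SOME F. laurent_expansion (q_rat r) = fls_of_int_fls F)"

lemma laurent_expansion_q_rat: "laurent_expansion (q_rat r) = fls_of_int_fls (q_series r)"
  unfolding q_series_def using laurent_expansion_q_rat_integral by (rule someI_ex)

lemma q_series_add_one: "q_series (r + 1) = fls_X * q_series r + 1"
proof -
  have "fls_of_int_fls (q_series (r + 1)) = fls_of_int_fls (fls_X * q_series r + 1)"
    by (simp add: q_rat_add_one laurent_expansion_add laurent_expansion_mult fls_of_int_fls_hom
        flip: laurent_expansion_q_rat)
  then show ?thesis
    by simp
qed

lemma q_series_neg_recip:
  assumes "r \<noteq> 0"
  shows "fls_X * q_series r * q_series (- 1 / r) = - 1"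
proof -
  have "fls_of_int_fls (fls_X * q_series r * q_series (- 1 / r)) =
      laurent_expansion (q_var * q_rat r * q_rat (- 1 / r))"
    by (simp only: fls_of_int_fls_hom laurent_expansion_mult laurent_expansion_q_rat
        laurent_expansion_q_var fls_of_int_fls_X)
  also have "\<dots> = fls_of_int_fls (- 1)"
    by (simp only: q_rat_neg_recip[OF assms] laurent_expansion_minus fls_of_int_fls_minus
        laurent_expansion_1 fls_of_int_fls_1)
  finally show ?thesis
    by simp
qed

lemma q_series_nth_neg:
  assumes "0 \<le> r" "k < 0"
  shows "q_series r $$ k = 0"
proof -
  obtain f where "fls_of_int_fls (q_series r) = fls_of_int_fls (fps_to_fls f)"
    using laurent_expansion_q_rat_fps[OF assms(1)] laurent_expansion_q_rat by metis
  then show ?thesis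
    using assms(2) by simp
qed

text \<open>In this form \<open>1 - [r / (1 + r)]\<close> is visibly a unit with known inverse, so
  differences of such series can be compared with differences of their inverses.\<close>

lemma q_series_slope:
  assumes "0 < r"
  shows "(1 - q_series (r / (1 + r))) * (1 + fls_X * q_series r) = 1"
proof -
  have "r / (1 + r) = - 1 / (r + 1) + 1"
    using assms by (simp add: field_simps)
  then have "q_series (r / (1 + r)) = fls_X * q_series (- 1 / (r + 1)) + 1"
    by (metis q_series_add_one)
  moreover have "fls_X * (fls_X * q_series r + 1) * q_series (- 1 / (r + 1)) = - 1"
    using q_series_neg_recip[of "r + 1"] assms by (simp add: q_series_add_one)
  ultimately show ?thesis
    by algebra
qed

lemma q_tendsto_iff:
  "q_tendsto xs L \<longleftrightarrow> (\<forall>k. \<forall>\<^sub>F n in sequentially. q_series (xs n) $$ k = L $$ k)"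
  by (simp add: q_tendsto_def laurent_expansion_q_rat flip: q_rat_def)

subsection \<open>Deformed irrationals\<close>

text \<open>The \<open>q\<close>-adic filtration. It is phrased by coefficients because
  \<open>fls_subdegree 0 = 0\<close> would misplace the zero series.\<close>

definition fls_vanishing_below :: "int \<Rightarrow> 'a::zero fls set" where
  "fls_vanishing_below n = {F. \<forall>k<n. F $$ k = 0}"

lemma fls_vanishing_below_mono: "m \<le> n \<Longrightarrow> F \<in> fls_vanishing_below n \<Longrightarrow> F \<in> fls_vanishing_below m"
  by (auto simp: fls_vanishing_below_def)

lemma fls_vanishing_below_add:
  fixes F G :: "'a::comm_ring_1 fls"
  shows "F \<in> fls_vanishing_below n \<Longrightarrow> G \<in> fls_vanishing_below n \<Longrightarrow> F + G \<in> fls_vanishing_below n"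
  by (auto simp: fls_vanishing_below_def)

lemma fls_vanishing_below_minus:
  fixes F :: "'a::comm_ring_1 fls"
  shows "- F \<in> fls_vanishing_below n \<longleftrightarrow> F \<in> fls_vanishing_below n"
  by (simp add: fls_vanishing_below_def)

lemma fls_vanishing_below_subdegree: "F \<in> fls_vanishing_below (fls_subdegree F)"
  by (simp add: fls_vanishing_below_def)

lemma fls_vanishing_below_mult:
  fixes F G :: "'a::comm_ring_1 fls"
  assumes "F \<in> fls_vanishing_below m" "G \<in> fls_vanishing_below n"
  shows "F * G \<in> fls_vanishing_below (m + n)"
proof (cases "F = 0 \<or> G = 0")
  case False
  then have "m \<le> fls_subdegree F" "n \<le> fls_subdegree G"
    using assms by (auto simp: fls_vanishing_below_def intro!: fls_subdegree_geI)
  then show ?thesis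
    by (auto simp: fls_vanishing_below_def intro!: fls_times_nth_eq0)
qed (auto simp: fls_vanishing_below_def)

lemma fls_X_vanishing_below: "fls_X \<in> fls_vanishing_below 1"
  and fls_X_inv_vanishing_below: "fls_X_inv \<in> fls_vanishing_below (- 1)"
  by (simp_all add: fls_vanishing_below_def)

text \<open>Rational points near \<open>x\<close> as a filter. It replaces sequences: several
  conditions can be imposed at once and transported along the modular maps.\<close>

definition rat_nhds :: "real \<Rightarrow> rat filter" where
  "rat_nhds x = filtercomap of_rat (nhds x)"

lemma filterlim_of_rat_rat_nhds: "((of_rat :: rat \<Rightarrow> real) \<longlongrightarrow> x) (rat_nhds x)"
  unfolding rat_nhds_def by (rule filterlim_filtercomap)

lemma filterlim_rat_nhdsI: "((\<lambda>r. of_rat (f r)) \<longlongrightarrow> x) F \<Longrightarrow> filterlim f (rat_nhds x) F"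
  by (simp add: rat_nhds_def filterlim_filtercomap_iff o_def)

lemma filterlim_add_one_rat_nhds: "filterlim (\<lambda>r. r + 1) (rat_nhds (x + 1)) (rat_nhds x)"
  by (rule filterlim_rat_nhdsI)
    (auto simp: of_rat_add intro!: tendsto_intros filterlim_of_rat_rat_nhds)

lemma filterlim_diff_one_rat_nhds: "filterlim (\<lambda>r. r - 1) (rat_nhds (x - 1)) (rat_nhds x)"
  by (rule filterlim_rat_nhdsI)
    (auto simp: of_rat_diff intro!: tendsto_intros filterlim_of_rat_rat_nhds)

lemma filterlim_neg_recip_rat_nhds:
  "x \<noteq> 0 \<Longrightarrow> filterlim (\<lambda>r. - 1 / r) (rat_nhds (- 1 / x)) (rat_nhds x)"
  by (rule filterlim_rat_nhdsI)
    (auto simp: of_rat_divide of_rat_minus intro!: tendsto_intros filterlim_of_rat_rat_nhds)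

lemma filterlim_slope_rat_nhds:
  "x \<noteq> 1 \<Longrightarrow> filterlim (\<lambda>r. r / (1 - r)) (rat_nhds (x / (1 - x))) (rat_nhds x)"
  by (rule filterlim_rat_nhdsI)
    (auto simp: of_rat_divide of_rat_diff intro!: tendsto_intros filterlim_of_rat_rat_nhds)

lemma eventually_rat_nhds_less:
  "x < of_rat a \<Longrightarrow> \<forall>\<^sub>F r in rat_nhds x. r < a"
  "of_rat a < x \<Longrightarrow> \<forall>\<^sub>F r in rat_nhds x. a < r"
  using order_tendstoD(2)[OF filterlim_of_rat_rat_nhds, of x "of_rat a"]
    order_tendstoD(1)[OF filterlim_of_rat_rat_nhds, of "of_rat a" x]
  by (simp_all add: of_rat_less)

text \<open>Density of the rationals; it lets a single rational be picked that meets all eventual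
  conditions.\<close>

lemma rat_nhds_neq_bot [simp]: "rat_nhds x \<noteq> bot"
  unfolding rat_nhds_def
proof (rule filtercomap_neq_bot)
  fix P :: "real \<Rightarrow> bool"
  assume "eventually P (nhds x)"
  then obtain e where e: "0 < e" "\<And>y. dist y x < e \<Longrightarrow> P y"
    by (auto simp: eventually_nhds_metric)
  obtain r where "x - e < of_rat r" "of_rat r < x + e"
    using of_rat_dense[of "x - e" "x + e"] e(1) by auto
  then show "\<exists>r. P (of_rat r)"
    using e(2)[of "of_rat r"] by (auto simp: dist_real_def abs_less_iff)
qed

text \<open>
  Each step down the Stern--Brocot tree, \<open>r \<mapsto> r - 1\<close> or \<open>r \<mapsto> r / (1 - r)\<close>, is undone by a map
  under which the difference of two deformations gains a factor \<open>q\<close>.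
\<close>

lemma q_series_locally_constant_mod:
  assumes "0 < x" "x \<notin> \<rat>"
  shows "\<exists>s>0. \<forall>\<^sub>F r in rat_nhds x. q_series r - q_series s \<in> fls_vanishing_below (int n)"
  using assms
proof (induction n arbitrary: x)
  case 0
  \<comment> \<open>The base point 1 is arbitrary: at positive rationals the series have no negative
    powers.\<close>
  have "\<forall>\<^sub>F r in rat_nhds x. q_series r - q_series 1 \<in> fls_vanishing_below 0"
    using eventually_rat_nhds_less(2)[of 0 x]
    by (rule eventually_mono) (use 0 in \<open>auto simp: fls_vanishing_below_def q_series_nth_neg\<close>)
  then show ?case
    by (intro exI[of _ 1]) simp
next
  case (Suc n)
  consider "1 < x" | "x < 1"
    using Suc.prems by (metis Rats_1 linorder_neqE)
  then show ?case
  proof cases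
    case 1
    moreover have "x - 1 \<notin> \<rat>"
      using Suc.prems Rats_add[of "x - 1" 1] by auto
    ultimately obtain s where s: "0 < s"
      "\<forall>\<^sub>F r in rat_nhds (x - 1). q_series r - q_series s \<in> fls_vanishing_below (int n)"
      using Suc.IH[of "x - 1"] by auto
    have "\<forall>\<^sub>F r in rat_nhds x. q_series (r - 1) - q_series s \<in> fls_vanishing_below (int n)"
      using s(2) filterlim_diff_one_rat_nhds by (rule eventually_compose_filterlim)
    then have "\<forall>\<^sub>F r in rat_nhds x. q_series r - q_series (s + 1) \<in> fls_vanishing_below (int (Suc n))"
    proof (rule eventually_mono)
      fix r
      assume "q_series (r - 1) - q_series s \<in> fls_vanishing_below (int n)"
      from fls_vanishing_below_mult[OF fls_X_vanishing_below this]
      show "q_series r - q_series (s + 1) \<in> fls_vanishing_below (int (Suc n))"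
        using q_series_add_one[of "r - 1"] by (simp add: q_series_add_one[of s] right_diff_distrib)
    qed
    then show ?thesis
      using s(1) by (intro exI[of _ "s + 1"]) simp
  next
    case 2
    have "x / (1 - x) \<notin> \<rat>"
    proof
      assume "x / (1 - x) \<in> \<rat>"
      from Rats_divide[OF this Rats_add[OF Rats_1 this]]
      have "x / (1 - x) / (1 + x / (1 - x)) \<in> \<rat>" .
      moreover have "x / (1 - x) / (1 + x / (1 - x)) = x"
        using 2 by (simp add: field_simps)
      ultimately show False
        using Suc.prems by simp
    qed
    then obtain s where s: "0 < s"
      "\<forall>\<^sub>F r in rat_nhds (x / (1 - x)). q_series r - q_series s \<in> fls_vanishing_below (int n)"
      using Suc.IH[of "x / (1 - x)"] 2 Suc.prems by auto
    have "\<forall>\<^sub>F r in rat_nhds x. q_series (r / (1 - r)) - q_series s \<in> fls_vanishing_below (int n)"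
      using s(2) filterlim_slope_rat_nhds by (rule eventually_compose_filterlim) (use 2 in simp)
    moreover have "\<forall>\<^sub>F r in rat_nhds x. 0 < r" "\<forall>\<^sub>F r in rat_nhds x. r < 1"
      using Suc.prems 2 by (auto intro!: eventually_rat_nhds_less)
    ultimately have "\<forall>\<^sub>F r in rat_nhds x.
        q_series r - q_series (s / (1 + s)) \<in> fls_vanishing_below (int (Suc n))"
    proof eventually_elim
      case (elim r)
      define t where "t = r / (1 - r)"
      have t: "0 < t" "t / (1 + t) = r"
        using elim by (simp_all add: t_def field_simps)
      let ?u = "s / (1 + s)"
      \<comment> \<open>With \<open>A = 1 - [r]\<close> and \<open>B = 1 - [?u]\<close>, this is
        \<open>B - A = A B (1/A - 1/B)\<close>, the inverses being \<open>1 + q [t]\<close> and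
        \<open>1 + q [s]\<close>.\<close>
      have "q_series r - q_series ?u
          = (fls_X * (q_series t - q_series s)) * ((1 - q_series r) * (1 - q_series ?u))"
        using q_series_slope[OF t(1)] q_series_slope[OF s(1)] unfolding t(2) by algebra
      moreover have "1 - q_series v \<in> fls_vanishing_below 0" if "0 \<le> v" for v
        using q_series_nth_neg[OF that] by (simp add: fls_vanishing_below_def)
      then have "(1 - q_series r) * (1 - q_series ?u) \<in> fls_vanishing_below (0 + 0)"
        using elim s(1) by (intro fls_vanishing_below_mult) simp_all
      moreover have "fls_X * (q_series t - q_series s) \<in> fls_vanishing_below (1 + int n)"
        using elim by (intro fls_vanishing_below_mult fls_X_vanishing_below) (simp add: t_def)
      ultimately show ?case
        using fls_vanishing_below_mult by fastforce
    qed
    then show ?thesis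
      using s(1) by (intro exI[of _ "s / (1 + s)"]) simp
  qed
qed

text \<open>Negative \<open>x\<close> are shifted to the positive side. Shifting back divides by
  \<open>q\<close> and costs one order of precision, hence \<open>n\<close> is generalized and the
  hypothesis is used at \<open>Suc n\<close>.\<close>

lemma q_series_cauchy:
  assumes "x \<notin> \<rat>"
  shows "\<exists>C. \<forall>\<^sub>F r in rat_nhds x. q_series r - C \<in> fls_vanishing_below (int n)"
proof -
  have "\<forall>x n. x \<notin> \<rat> \<longrightarrow> 0 < x + of_nat m \<longrightarrow>
      (\<exists>C. \<forall>\<^sub>F r in rat_nhds x. q_series r - C \<in> fls_vanishing_below (int n))" for m
  proof (induction m)
    case 0
    then show ?case
      using q_series_locally_constant_mod by fastforce
  next
    case (Suc m)
    show ?case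
    proof (intro allI impI)
      fix x :: real and n
      assume "x \<notin> \<rat>" "0 < x + of_nat (Suc m)"
      moreover have "x + 1 \<notin> \<rat>"
        using \<open>x \<notin> \<rat>\<close> Rats_diff[of "x + 1" 1] by auto
      ultimately obtain C where C:
        "\<forall>\<^sub>F r in rat_nhds (x + 1). q_series r - C \<in> fls_vanishing_below (int (Suc n))"
        using Suc[rule_format, of "x + 1" "Suc n"] by (auto simp: add_ac)
      have "\<forall>\<^sub>F r in rat_nhds x. q_series (r + 1) - C \<in> fls_vanishing_below (int (Suc n))"
        using C filterlim_add_one_rat_nhds by (rule eventually_compose_filterlim)
      then have "\<forall>\<^sub>F r in rat_nhds x. q_series r - fls_X_inv * (C - 1) \<in> fls_vanishing_below (int n)"
      proof (rule eventually_mono)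
        fix r
        assume "q_series (r + 1) - C \<in> fls_vanishing_below (int (Suc n))"
        from fls_vanishing_below_mult[OF fls_X_inv_vanishing_below this]
        have "fls_X_inv * (q_series (r + 1) - C) \<in> fls_vanishing_below (int n)"
          by simp
        moreover have "fls_X_inv * (q_series (r + 1) - C) = q_series r - fls_X_inv * (C - 1)"
          using fls_X_inv_mult_X[where 'a = int] unfolding q_series_add_one by algebra
        ultimately show "q_series r - fls_X_inv * (C - 1) \<in> fls_vanishing_below (int n)"
          by simp
      qed
      then show "\<exists>C. \<forall>\<^sub>F r in rat_nhds x. q_series r - C \<in> fls_vanishing_below (int n)"
        by blast
    qed
  qed
  moreover obtain m :: nat where "- x < of_nat m"
    using reals_Archimedean2 by blast
  then have "0 < x + of_nat m"
    by linarith
  ultimately show ?thesis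
    using assms by blast
qed

text \<open>
  Unlike coefficientwise convergence, this notion bounds the orders of the poles uniformly, so that
  it is compatible with products.
\<close>

definition q_limit :: "real \<Rightarrow> int fls \<Rightarrow> bool" where
  "q_limit x L \<longleftrightarrow> (\<forall>n. \<forall>\<^sub>F r in rat_nhds x. q_series r - L \<in> fls_vanishing_below n)"

lemma q_limit_exists:
  assumes "x \<notin> \<rat>"
  shows "\<exists>L. q_limit x L"
proof -
  obtain C where C: "\<forall>\<^sub>F r in rat_nhds x. q_series r - C n \<in> fls_vanishing_below (int n)" for n
    using q_series_cauchy[OF assms] by metis
  \<comment> \<open>\<open>C n\<close> is reliable below order \<open>n\<close>, so coefficient
    \<open>k\<close> is read from \<open>C (k + 1)\<close>. For negative \<open>k\<close> the index
    is 0, and \<open>C 0\<close> alone bounds the pole.\<close>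
  define L where "L = Abs_fls (\<lambda>k. C (nat (k + 1)) $$ k)"
  have C_agree: "C m $$ k = C n $$ k" if "k < int m" "k < int n" for m n k
  proof -
    have "\<exists>r. q_series r - C m \<in> fls_vanishing_below (int m) \<and>
        q_series r - C n \<in> fls_vanishing_below (int n)"
      using eventually_happens'[OF rat_nhds_neq_bot eventually_conj[OF C C]] .
    with that show ?thesis
      by (auto simp: fls_vanishing_below_def)
  qed
  have L: "L $$ k = C (nat (k + 1)) $$ k" for k
    unfolding L_def
  proof (rule nth_Abs_fls_lower_bound[of "min 0 (fls_subdegree (C 0))"], intro allI impI)
    fix k
    assume "k < min 0 (fls_subdegree (C 0))"
    then show "C (nat (k + 1)) $$ k = 0"
      using C_agree[of k 0 "nat (k + 1)"] by simp
  qed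
  have "\<forall>\<^sub>F r in rat_nhds x. q_series r - L \<in> fls_vanishing_below n" for n
    using C[of "nat n"]
  proof (rule eventually_mono)
    fix r
    assume r: "q_series r - C (nat n) \<in> fls_vanishing_below (int (nat n))"
    show "q_series r - L \<in> fls_vanishing_below n"
      unfolding fls_vanishing_below_def
    proof (intro CollectI allI impI)
      fix k
      assume "k < n"
      then have "k < int (nat n)"
        by simp
      then have "q_series r $$ k = C (nat n) $$ k"
        using r by (simp add: fls_vanishing_below_def)
      also have "\<dots> = L $$ k"
        using C_agree[of k "nat n" "nat (k + 1)"] \<open>k < int (nat n)\<close> by (simp add: L)
      finally show "(q_series r - L) $$ k = 0"
        by simp
    qed
  qed
  then show ?thesis
    unfolding q_limit_def by blast
qed

lemma q_limit_imp_q_tendsto: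
  assumes "q_limit x L" "(\<lambda>n. of_rat (xs n)) \<longlonglongrightarrow> x"
  shows "q_tendsto xs L"
  unfolding q_tendsto_iff
proof
  fix k
  have "\<forall>\<^sub>F r in rat_nhds x. q_series r - L \<in> fls_vanishing_below (k + 1)"
    using assms(1) by (simp add: q_limit_def)
  from eventually_compose_filterlim[OF this filterlim_rat_nhdsI[OF assms(2)]]
  show "\<forall>\<^sub>F n in sequentially. q_series (xs n) $$ k = L $$ k"
    by (rule eventually_mono) (simp add: fls_vanishing_below_def)
qed

lemma q_tendsto_unique:
  assumes "q_tendsto xs L" "q_tendsto xs M"
  shows "L = M"
proof (rule fls_eqI)
  fix k
  have "\<forall>\<^sub>F n in sequentially. q_series (xs n) $$ k = L $$ k \<and> q_series (xs n) $$ k = M $$ k"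
    using assms by (intro eventually_conj) (simp_all add: q_tendsto_iff)
  from eventually_happens'[OF sequentially_bot this] show "L $$ k = M $$ k"
    by auto
qed

text \<open>Without such a sequence the condition defining \<open>q_irrational\<close> would be
  vacuous and would not determine the limit.\<close>

lemma rat_sequence_tendsto:
  fixes x :: real
  obtains xs :: "nat \<Rightarrow> rat" where "(\<lambda>n. of_rat (xs n)) \<longlonglongrightarrow> x"
proof -
  have "\<exists>r. x < of_rat r \<and> of_rat r < x + inverse (real (Suc n))" for n
    using of_rat_dense[of x "x + inverse (real (Suc n))"] by simp
  then obtain xs where xs: "\<And>n. x < of_rat (xs n)" "\<And>n. of_rat (xs n) < x + inverse (real (Suc n))"
    by metis
  have "(\<lambda>n. x + inverse (real (Suc n))) \<longlonglongrightarrow> x"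
    using tendsto_add[OF tendsto_const[of x] LIMSEQ_inverse_real_of_nat] by simp
  then have "(\<lambda>n. of_rat (xs n)) \<longlonglongrightarrow> x"
    by (rule tendsto_sandwich[rotated 2, OF tendsto_const])
      (use xs in \<open>auto intro!: always_eventually less_imp_le simp del: of_nat_Suc\<close>)
  then show thesis
    by (rule that)
qed

lemma q_limit_q_irrational:
  assumes "x \<notin> \<rat>"
  shows "q_limit x (q_irrational x)"
proof -
  obtain L where L: "q_limit x L"
    using q_limit_exists[OF assms] by blast
  obtain xs where xs: "(\<lambda>n. of_rat (xs n)) \<longlonglongrightarrow> x"
    by (rule rat_sequence_tendsto)
  have "q_irrational x = L"
    unfolding q_irrational_def
  proof (rule the_equality)
    show "\<forall>xs. (\<lambda>n. of_rat (xs n)) \<longlonglongrightarrow> x \<longrightarrow> q_tendsto xs L"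
      using q_limit_imp_q_tendsto[OF L] by blast
    show "M = L" if "\<forall>xs. (\<lambda>n. of_rat (xs n)) \<longlonglongrightarrow> x \<longrightarrow> q_tendsto xs M" for M
      using that xs q_limit_imp_q_tendsto[OF L] q_tendsto_unique by blast
  qed
  with L show ?thesis
    by simp
qed

lemma fls_eq_if_diff_vanishing_below:
  fixes F G :: "int fls"
  assumes "\<And>n. F - G \<in> fls_vanishing_below n"
  shows "F = G"
proof (rule fls_eqI)
  fix k
  show "F $$ k = G $$ k"
    using assms[of "k + 1"] by (simp add: fls_vanishing_below_def)
qed

text \<open>The rational rule is compared with its limit at one \<open>r\<close> for which
  \<open>r\<close> and \<open>r + 1\<close> both approximate to order \<open>n\<close>.\<close>

lemma q_irrational_add_one:
  assumes "x \<notin> \<rat>"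
  shows "q_irrational (x + 1) = fls_X * q_irrational x + 1"
proof (rule fls_eq_if_diff_vanishing_below)
  fix n
  have "x + 1 \<notin> \<rat>"
    using assms Rats_diff[of "x + 1" 1] by auto
  then have "\<forall>\<^sub>F r in rat_nhds (x + 1). q_series r - q_irrational (x + 1) \<in> fls_vanishing_below n"
    using q_limit_q_irrational by (simp add: q_limit_def)
  then have "\<forall>\<^sub>F r in rat_nhds x. q_series (r + 1) - q_irrational (x + 1) \<in> fls_vanishing_below n"
    using filterlim_add_one_rat_nhds by (rule eventually_compose_filterlim)
  moreover have "\<forall>\<^sub>F r in rat_nhds x. q_series r - q_irrational x \<in> fls_vanishing_below n"
    using assms q_limit_q_irrational by (simp add: q_limit_def)
  ultimately have "\<exists>r. q_series (r + 1) - q_irrational (x + 1) \<in> fls_vanishing_below n \<and>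
      q_series r - q_irrational x \<in> fls_vanishing_below n"
    by (intro eventually_happens'[OF rat_nhds_neq_bot eventually_conj])
  then obtain r where r: "q_series (r + 1) - q_irrational (x + 1) \<in> fls_vanishing_below n"
    "q_series r - q_irrational x \<in> fls_vanishing_below n"
    by blast
  have "fls_X * (q_series r - q_irrational x) \<in> fls_vanishing_below n"
    using fls_vanishing_below_mult[OF fls_X_vanishing_below r(2)]
    by (rule fls_vanishing_below_mono[rotated]) simp
  then have "fls_X * (q_series r - q_irrational x) - (q_series (r + 1) - q_irrational (x + 1))
      \<in> fls_vanishing_below n"
    using r(1) by (simp add: fls_vanishing_below_def)
  moreover have "q_irrational (x + 1) - (fls_X * q_irrational x + 1)
      = fls_X * (q_series r - q_irrational x) - (q_series (r + 1) - q_irrational (x + 1))"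
    unfolding q_series_add_one by algebra
  ultimately show "q_irrational (x + 1) - (fls_X * q_irrational x + 1) \<in> fls_vanishing_below n"
    by (simp only:)
qed

lemma q_irrational_neg_recip:
  assumes "x \<notin> \<rat>"
  shows "fls_X * q_irrational x * q_irrational (- 1 / x) = - 1"
proof (rule fls_eq_if_diff_vanishing_below)
  fix n
  have "x \<noteq> 0"
    using assms by auto
  have "- 1 / x \<notin> \<rat>"
  proof
    assume "- 1 / x \<in> \<rat>"
    then have "- 1 / (- 1 / x) \<in> \<rat>"
      using Rats_divide Rats_minus_iff Rats_1 by metis
    with assms show False
      by simp
  qed
  define L M where "L = q_irrational x" and "M = q_irrational (- 1 / x)"
  define a b where "a = fls_subdegree L" and "b = fls_subdegree M"
  \<comment> \<open>The precision absorbs the poles of \<open>L\<close> and \<open>M\<close>: the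
    errors \<open>?D * ?E\<close>, \<open>?D * M\<close> and \<open>L * ?E\<close> then all vanish
    below \<open>n\<close>.\<close>
  define N where "N = max (max 0 n) (max (n - a) (n - b))"
  have "\<forall>\<^sub>F r in rat_nhds (- 1 / x). q_series r - M \<in> fls_vanishing_below N"
    using q_limit_q_irrational \<open>- 1 / x \<notin> \<rat>\<close> by (simp add: q_limit_def M_def)
  then have "\<forall>\<^sub>F r in rat_nhds x. q_series (- 1 / r) - M \<in> fls_vanishing_below N"
    using filterlim_neg_recip_rat_nhds[OF \<open>x \<noteq> 0\<close>] by (rule eventually_compose_filterlim)
  moreover have "\<forall>\<^sub>F r in rat_nhds x. q_series r - L \<in> fls_vanishing_below N"
    using assms q_limit_q_irrational by (simp add: q_limit_def L_def)
  moreover have "\<forall>\<^sub>F r in rat_nhds x. r \<noteq> 0"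
  proof -
    have "\<forall>\<^sub>F r in rat_nhds x. of_rat r \<noteq> (0 :: real)"
      using filterlim_of_rat_rat_nhds \<open>x \<noteq> 0\<close> by (rule tendsto_imp_eventually_ne)
    then show ?thesis
      by simp
  qed
  ultimately have "\<exists>r. q_series (- 1 / r) - M \<in> fls_vanishing_below N \<and>
      q_series r - L \<in> fls_vanishing_below N \<and> r \<noteq> 0"
    by (intro eventually_happens'[OF rat_nhds_neq_bot] eventually_conj)
  then obtain r where r: "q_series (- 1 / r) - M \<in> fls_vanishing_below N"
    "q_series r - L \<in> fls_vanishing_below N" "r \<noteq> 0"
    by blast
  let ?D = "q_series r - L" and ?E = "q_series (- 1 / r) - M"
  have "n \<le> N + N" "n \<le> N + b" "n \<le> a + N"
    unfolding N_def by linarith+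
  then have "?D * ?E \<in> fls_vanishing_below n" "?D * M \<in> fls_vanishing_below n"
    "L * ?E \<in> fls_vanishing_below n"
    using fls_vanishing_below_mult[OF r(2) r(1)]
      fls_vanishing_below_mult[OF r(2) fls_vanishing_below_subdegree[of M]]
      fls_vanishing_below_mult[OF fls_vanishing_below_subdegree[of L] r(1)]
    unfolding a_def b_def by (blast intro: fls_vanishing_below_mono)+
  then have "?D * ?E + ?D * M + L * ?E \<in> fls_vanishing_below n"
    by (intro fls_vanishing_below_add)
  from fls_vanishing_below_mult[OF fls_X_vanishing_below this]
  have "fls_X * (?D * ?E + ?D * M + L * ?E) \<in> fls_vanishing_below n"
    by (rule fls_vanishing_below_mono[rotated]) simp
  moreover have "fls_X * L * M - (- 1) = - (fls_X * (?D * ?E + ?D * M + L * ?E))"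
    using q_series_neg_recip[OF r(3)] by algebra
  ultimately show "fls_X * q_irrational x * q_irrational (- 1 / x) - (- 1) \<in> fls_vanishing_below n"
    unfolding L_def [symmetric] M_def [symmetric] by (simp only: fls_vanishing_below_minus)
qed

subsection \<open>Cubics invariant under an order three homography\<close>

lemma cyclic_cubic_factorization:
  fixes X Y Z u t :: "'a::comm_ring_1"
  assumes "X * Y = - u * X - u ^ 2" "Y * Z = - u * Y - u ^ 2" "Z * X = - u * Z - u ^ 2"
  defines "E \<equiv> X + Y + Z"
  shows "t ^ 3 - E * t ^ 2 - (u * E + 3 * u ^ 2) * t - u ^ 3 = (t - X) * (t - Y) * (t - Z)"
proof -
  have e2: "X * Y + Y * Z + Z * X = - u * E - 3 * u ^ 2"
    unfolding assms(1-3) E_def by (simp add: algebra_simps)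
  have "X * Y * Z = - u * (Z * X) - u ^ 2 * Z"
    unfolding assms(1) by (simp add: algebra_simps)
  then have e3: "X * Y * Z = u ^ 3"
    unfolding assms(3) by (simp add: algebra_simps power2_eq_square power3_eq_cube)
  have "(t - X) * (t - Y) * (t - Z) = t ^ 3 - E * t ^ 2 + (X * Y + Y * Z + Z * X) * t - X * Y * Z"
    unfolding E_def by (simp add: algebra_simps power2_eq_square power3_eq_cube)
  then show ?thesis
    unfolding e2 e3 by (simp add: algebra_simps)
qed

text \<open>For odd \<open>u\<close> the cubic reduces modulo 2 to
  \<open>x^3 + b x^2 + (b + 1) x + 1\<close>, which is irreducible for either parity of
  \<open>b\<close>. The homogenized equation would thus force \<open>a\<close> and \<open>c\<close>
  both even.\<close>

lemma cyclic_cubic_no_rational_root: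
  fixes x :: real and b u :: int
  assumes "odd u"
    and "x ^ 3 - of_int b * x ^ 2 - (of_int u * of_int b + 3 * of_int u ^ 2) * x - of_int u ^ 3 = 0"
  shows "x \<notin> \<rat>"
proof
  assume "x \<in> \<rat>"
  then obtain a c :: int where c: "c > 0" "coprime a c" and x: "x = of_int a / of_int c"
    by (rule Rats_cases')
  have "real_of_int c ^ 3 * (x ^ 3 - of_int b * x ^ 2
      - (of_int u * of_int b + 3 * of_int u ^ 2) * x - of_int u ^ 3) =
      real_of_int (a ^ 3 - b * a ^ 2 * c - (u * b + 3 * u ^ 2) * a * c ^ 2 - u ^ 3 * c ^ 3)"
    using c by (simp add: x field_simps power2_eq_square power3_eq_cube)
  then have "a ^ 3 - b * a ^ 2 * c - (u * b + 3 * u ^ 2) * a * c ^ 2 - u ^ 3 * c ^ 3 = 0"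
    using assms(2) by (metis mult_zero_right of_int_eq_0_iff)
  then have "even (a ^ 3 - b * a ^ 2 * c - (u * b + 3 * u ^ 2) * a * c ^ 2 - u ^ 3 * c ^ 3)"
    by simp
  then have "even a \<and> even c"
    using \<open>odd u\<close> by (auto simp: even_add)
  then show False
    using c by (metis coprime_common_divisor odd_one)
qed

lemma cyclic_cubic_roots:
  fixes b u :: int
  assumes u: "u = 1 \<or> u = - 1"
  defines "R \<equiv> {x :: real. x ^ 3 - of_int b * x ^ 2
    - (of_int u * of_int b + 3 * of_int u ^ 2) * x - of_int u ^ 3 = 0}"
  shows "card R = 3" and "R \<inter> \<rat> = {}"
    and "\<exists>x y z. R = {x, y, z} \<and> y = - of_int u - 1 / x \<and> z = - of_int u - 1 / y \<and> x = - of_int u - 1 / z"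
proof -
  define v where "v = real_of_int u"
  have v: "v = 1 \<or> v = - 1"
    using u by (auto simp: v_def)
  then have v2: "v ^ 2 = 1"
    by auto
  define p where "p x = x ^ 3 - of_int b * x ^ 2 - (v * of_int b + 3 * v ^ 2) * x - v ^ 3" for x
  have R: "R = {x. p x = 0}"
    by (simp add: R_def p_def v_def)
  have cont: "continuous_on A p" for A
    unfolding p_def by (intro continuous_intros)
  \<comment> \<open>A sign change gives one root between 0 and \<open>- v\<close>; the homography
    supplies the other two.\<close>
  have ends: "p 0 = - v" "p (- v) = v"
    using v by (auto simp: p_def)
  obtain x where x: "p x = 0"
  proof (cases "v = 1")
    case True
    then show thesis
      using IVT2'[of p 0 0 "- 1"] ends cont that by auto
  next
    case False
    then show thesis
      using IVT2'[of p 1 0 0] ends cont that v by auto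
  qed
  have irr: "R \<inter> \<rat> = {}"
    using cyclic_cubic_no_rational_root[of u _ b] u unfolding R_def by auto
  have "x \<notin> \<rat>"
    using irr x by (auto simp: R)
  then have x0: "x \<noteq> 0" "x \<noteq> - v"
    using v by auto
  define y where "y = - v - 1 / x"
  define z where "z = - v - 1 / y"
  have "v + 1 / x = v * (x + v) / x"
    using x0 v2 by (simp add: field_simps power2_eq_square)
  then have "y = - v * (x + v) / x"
    by (simp add: y_def)
  moreover from this have "y \<noteq> 0"
    using x0 v by (simp add: add_eq_0_iff2) auto
  ultimately have y: "y = - v * (x + v) / x" "y \<noteq> 0"
    by blast+
  have z: "z = - 1 / (x + v)"
    using x0 y v by (auto simp: z_def field_simps)
  then have "z \<noteq> 0"
    using x0 by (simp add: add_eq_0_iff2)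
  have x_eq: "x = - v - 1 / z"
    using x0 by (simp add: z)
  have rel: "x * y = - v * x - v ^ 2" "y * z = - v * y - v ^ 2" "z * x = - v * z - v ^ 2"
  proof -
    show "x * y = - v * x - v ^ 2"
      using x0 unfolding y_def v2 by (simp add: field_simps)
    show "y * z = - v * y - v ^ 2"
      using y(2) unfolding z_def v2 by (simp add: field_simps)
    have "z * (- v - 1 / z) = - v * z - v ^ 2"
      using \<open>z \<noteq> 0\<close> unfolding v2 by (simp add: field_simps)
    then show "z * x = - v * z - v ^ 2"
      by (simp flip: x_eq)
  qed
  note fact = cyclic_cubic_factorization[OF rel]
  \<comment> \<open>The cubics with parameters \<open>b\<close> and \<open>x + y + z\<close> both
    vanish at \<open>x\<close>, and their difference at \<open>t\<close> is a multiple of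
    \<open>t * (t + v)\<close>. This identifies the parameters.\<close>
  have "(x + y + z - of_int b) * (x * (x + v)) = 0"
    using x fact[of x] unfolding p_def by algebra
  then have "x + y + z = of_int b"
    using x0 by (simp add: add_eq_0_iff2)
  then have "p t = (t - x) * (t - y) * (t - z)" for t
    using fact[of t] by (simp add: p_def)
  then have R_eq: "R = {x, y, z}"
    by (auto simp: R)
  \<comment> \<open>A coincidence of two roots would give a real fixed point of the homography, but
    the fixed-point quadratic has negative discriminant \<open>- 3 * v^2\<close>.\<close>
  have no_fixed: "s ^ 2 + v * s + v ^ 2 \<noteq> 0" for s
  proof
    assume "s ^ 2 + v * s + v ^ 2 = 0"
    then have "(2 * s + v) ^ 2 + 3 * v ^ 2 = 0"
      by algebra
    then show False
      using zero_le_power2[of "2 * s + v"] v2 by linarith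
  qed
  have "x \<noteq> y" "y \<noteq> z" "z \<noteq> x"
    using no_fixed[of x] no_fixed[of y] no_fixed[of z] rel
    by (auto simp: power2_eq_square algebra_simps)
  then show "card R = 3"
    by (simp add: R_eq)
  show "R \<inter> \<rat> = {}"
    by (fact irr)
  show "\<exists>x y z. R = {x, y, z} \<and> y = - of_int u - 1 / x \<and> z = - of_int u - 1 / y \<and> x = - of_int u - 1 / z"
    using R_eq x_eq y_def z_def unfolding v_def by blast
qed

lemma q_irrational_one_minus_recip:
  assumes "x \<notin> \<rat>" and "y = 1 - 1 / x"
  shows "q_irrational x * q_irrational y = q_irrational x - 1"
proof -
  have "- 1 / x \<notin> \<rat>"
    using assms(1) Rats_divide[of "- 1" "- 1 / x"] by auto
  then have "q_irrational y = fls_X * q_irrational (- 1 / x) + 1"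
    using q_irrational_add_one[of "- 1 / x"] assms(2) by simp
  with q_irrational_neg_recip[OF assms(1)] show ?thesis
    by algebra
qed

text \<open>The shift rule is applied backwards, at \<open>y\<close> with
  \<open>y + 1 = - 1 / x\<close>; the resulting identity is then divided by
  \<open>q^2\<close>.\<close>

lemma q_irrational_minus_one_minus_recip:
  assumes "x \<notin> \<rat>" "y \<notin> \<rat>" and "y = - 1 - 1 / x"
  shows "q_irrational x * q_irrational y = - fls_X_inv * q_irrational x - fls_X_inv ^ 2"
proof -
  have "q_irrational (- 1 / x) = fls_X * q_irrational y + 1"
    using q_irrational_add_one[of y] assms(2,3) by simp
  with q_irrational_neg_recip[OF assms(1)]
  have "fls_X * q_irrational x * (fls_X * q_irrational y + 1) = - 1"
    by simp
  with fls_X_inv_mult_X[where 'a = int] show ?thesis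
    by algebra
qed

theorem theorem1p1:
  fixes b :: int
  shows "(let R = {x :: real. x ^ 3 - of_int b * x ^ 2 + (of_int b - 3) * x + 1 = 0} in
            card R = 3 \<and> R \<inter> \<rat> = {} \<and>
            (\<exists>B :: int fls. \<forall>X \<in> q_irrational ` R.
               X ^ 3 - B * X ^ 2 + (B - 3) * X + 1 = 0)) \<and>
         (let R = {x :: real. x ^ 3 - of_int b * x ^ 2 - (of_int b + 3) * x - 1 = 0} in
            card R = 3 \<and> R \<inter> \<rat> = {} \<and>
            (\<exists>B :: int fls. \<forall>X \<in> q_irrational ` R.
               X ^ 3 - B * X ^ 2 - (fls_X_inv * B + 3 * fls_X_inv ^ 2) * X - fls_X_inv ^ 3 = 0))"
proof (intro conjI)
  let ?R = "{x :: real. x ^ 3 - of_int b * x ^ 2 + (of_int b - 3) * x + 1 = 0}"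
  have card: "card ?R = 3" and irr: "?R \<inter> \<rat> = {}"
    and ex: "\<exists>x y z. ?R = {x, y, z} \<and> y = 1 - 1 / x \<and> z = 1 - 1 / y \<and> x = 1 - 1 / z"
    using cyclic_cubic_roots[of "- 1" b] by (simp_all add: algebra_simps)
  from ex obtain x y z where R: "?R = {x, y, z}"
    and xyz: "y = 1 - 1 / x" "z = 1 - 1 / y" "x = 1 - 1 / z"
    by blast
  have xyz_irr: "x \<notin> \<rat>" "y \<notin> \<rat>" "z \<notin> \<rat>"
    using irr unfolding R by auto
  define X Y Z where "X = q_irrational x" and "Y = q_irrational y" and "Z = q_irrational z"
  have "X * Y = X - 1" "Y * Z = Y - 1" "Z * X = Z - 1"
    unfolding X_def Y_def Z_def using xyz xyz_irr q_irrational_one_minus_recip by blast+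
  then have "t ^ 3 - (X + Y + Z) * t ^ 2 + (X + Y + Z - 3) * t + 1 = (t - X) * (t - Y) * (t - Z)" for t
    using cyclic_cubic_factorization[of X Y "- 1" Z t] by (simp add: algebra_simps)
  then have "\<forall>F \<in> q_irrational ` ?R. F ^ 3 - (X + Y + Z) * F ^ 2 + (X + Y + Z - 3) * F + 1 = 0"
    unfolding R by (auto simp: X_def Y_def Z_def)
  with card irr show "let R = ?R in card R = 3 \<and> R \<inter> \<rat> = {} \<and>
      (\<exists>B :: int fls. \<forall>X \<in> q_irrational ` R. X ^ 3 - B * X ^ 2 + (B - 3) * X + 1 = 0)"
    unfolding Let_def by blast
next
  let ?R = "{x :: real. x ^ 3 - of_int b * x ^ 2 - (of_int b + 3) * x - 1 = 0}"
  have card: "card ?R = 3" and irr: "?R \<inter> \<rat> = {}"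
    and ex: "\<exists>x y z. ?R = {x, y, z} \<and> y = - 1 - 1 / x \<and> z = - 1 - 1 / y \<and> x = - 1 - 1 / z"
    using cyclic_cubic_roots[of 1 b] by simp_all
  from ex obtain x y z where R: "?R = {x, y, z}"
    and xyz: "y = - 1 - 1 / x" "z = - 1 - 1 / y" "x = - 1 - 1 / z"
    by blast
  have xyz_irr: "x \<notin> \<rat>" "y \<notin> \<rat>" "z \<notin> \<rat>"
    using irr unfolding R by auto
  define X Y Z where "X = q_irrational x" and "Y = q_irrational y" and "Z = q_irrational z"
  have "X * Y = - fls_X_inv * X - fls_X_inv ^ 2" "Y * Z = - fls_X_inv * Y - fls_X_inv ^ 2"
    "Z * X = - fls_X_inv * Z - fls_X_inv ^ 2"
    unfolding X_def Y_def Z_def using xyz xyz_irr q_irrational_minus_one_minus_recip by blast+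
  note fact = cyclic_cubic_factorization[OF this]
  have "\<forall>F \<in> q_irrational ` ?R. F ^ 3 - (X + Y + Z) * F ^ 2
      - (fls_X_inv * (X + Y + Z) + 3 * fls_X_inv ^ 2) * F - fls_X_inv ^ 3 = 0"
    unfolding R fact by (auto simp: X_def Y_def Z_def)
  with card irr show "let R = ?R in card R = 3 \<and> R \<inter> \<rat> = {} \<and>
      (\<exists>B :: int fls. \<forall>X \<in> q_irrational ` R.
        X ^ 3 - B * X ^ 2 - (fls_X_inv * B + 3 * fls_X_inv ^ 2) * X - fls_X_inv ^ 3 = 0)"
    unfolding Let_def by blast
qed

end
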